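(* Let $X_1,X_2$ be real random variables whose risk measures (as defined in the context) are finite, let $g(u)=F_{X_1}^{-1}(u)+F_{X_2}^{-1}(1-u)$, and let $S^l=g(U)$ with $U$ uniformly distributed on the unit interval, where $S^l$ is not degenerate. For any $x\in(x^{\min},x^{\max})$, let $u_1<\dots<u_N$ be the $N$ ordered elements of the set $E_x$. Then $$\pi_{S^l}(x)=\begin{cases}s_1(x), & \text{if } g(u)\le x \text{ for } u\in(0,u_1),\\ s_2(x), & \text{if } g(u)\ge x\text{ for } u\in(0,u_1),\end{cases}$$ where $$s_1(x)=\pi_{X_1}\!\left(F_{X_1}^{-1}(u_1)\right)-\lambda_{X_2}\!\left(F_{X_2}^{-1}(1-u_1)\right)-\mathcal{S}+(1-u_1)\left(g(u_1)-x\right)-\mathcal{J},$$ $$s_2(x)=\pi_{X_2}\!\left(F_{X_2}^{-1}(1-u_1)\right)-\lambda_{X_1}\!\left(F_{X_1}^{-1}(u_1)\right)+\mathcal{S}+u_1\left(g(u_1)-x\right)+\mathcal{J},$$ $$\mathcal{S}=\sum_{j=2}^{N}(-1)^j\left(\pi_{X_1}\!\left(F_{X_1}^{-1}(u_j)\right)-\lambda_{X_2}\!\left(F_{X_2}^{-1}(1-u_j)\right)\right),\qquad \mathcal{J}=\sum_{j=2}^{N}(-1)^j(1-u_j)\left(g(u_j)-x\right),$$ with the convention $\sum_{j=2}^{1}=0$.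
   Context: Random variables may be discrete, continuous, or a combination of the two. For a real random variable $X$ with cdf $F_X$, $F_X^{-1}(p)=\inf\{y\in\mathbb{R}: F_X(y)\ge p\}$, with $\inf\emptyset=+\infty$. The upper tail transform (stop-loss premium) is $\pi_X(x)=\mathbb{E}[(X-x)_+]$ and the lower tail transform is $\lambda_X(x)=\mathbb{E}[(x-X)_+]$, where $(y)_+=\max\{y,0\}$. $x^{\min}=\inf_{u\in[0,1]}g(u)$ and $x^{\max}=\sup_{u\in[0,1]}g(u)$. Set $E_x$ (associated with $g$), for $x\in(x^{\min},x^{\max})$: a point $u^*\in(0,1)$ belongs to $E_x$ if and only if there exist $a,b,c\in[0,1]$ with $a<b\le u^*<c$ such that one of the following holds: (1) $g(u)<x$ for $u\in(a,b)$, $g(u)=x$ for $u\in(b,u^* )$, and $g(u)>x$ for $u\in(u^*,c)$; (2) $g(u)>x$ for $u\in(a,b)$, $g(u)=x$ for $u\in(b,u^* )$, and $g(u)<x$ for $u\in(u^*,c)$. (If $b=u^*$ the middle requirement is vacuous.) $N$ denotes the number of elements of $E_x$; $E_x$ is at most countably infinite, and $N=\infty$ is allowed.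
   Formalization: Added, as the claim fails without it: on any interval free of points of E_x, g−x has weakly constant sign almost everywhere; and if N=∞, g=x almost everywhere beyond all u_j. E_x is taken nonempty, and for N=∞ listed as u_1<u_2<…; convergence of both series is proved. *)

theory Defs
  imports "HOL-Probability.Probability"
begin

text \<open>
  The infimum is taken in the extended reals, so it is \<open>\<infinity>\<close> on the empty set, and the quantile
  at \<open>0\<close> is \<open>-\<infinity>\<close>.  For \<open>0 < p < 1\<close> the value is always finite.
\<close>
definition quantile :: "'a measure \<Rightarrow> ('a \<Rightarrow> real) \<Rightarrow> real \<Rightarrow> ereal" where
  "quantile M X p = Inf (ereal ` {y. cdf (distr M borel X) y \<ge> p})"

definition upper_tail :: "'a measure \<Rightarrow> ('a \<Rightarrow> real) \<Rightarrow> real \<Rightarrow> real" where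
  "upper_tail M X x = (\<integral>\<omega>. max (X \<omega> - x) 0 \<partial>M)"

definition lower_tail :: "'a measure \<Rightarrow> ('a \<Rightarrow> real) \<Rightarrow> real \<Rightarrow> real" where
  "lower_tail M X x = (\<integral>\<omega>. max (x - X \<omega>) 0 \<partial>M)"

definition finite_tail_transforms :: "'a measure \<Rightarrow> ('a \<Rightarrow> real) \<Rightarrow> bool" where
  "finite_tail_transforms M X \<longleftrightarrow>
     (\<forall>x. integrable M (\<lambda>\<omega>. max (X \<omega> - x) 0) \<and> integrable M (\<lambda>\<omega>. max (x - X \<omega>) 0))"

definition crossing_set :: "(real \<Rightarrow> ereal) \<Rightarrow> real \<Rightarrow> real set" where
  "crossing_set g x =
     {u \<in> {0<..<1}. \<exists>a\<in>{0..1}. \<exists>b\<in>{0..1}. \<exists>c\<in>{0..1}. a < b \<and> b \<le> u \<and> u < c \<and>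
        ((\<forall>v\<in>{a<..<b}. g v < ereal x) \<and> (\<forall>v\<in>{b<..<u}. g v = ereal x) \<and>
           (\<forall>v\<in>{u<..<c}. g v > ereal x) \<or>
         (\<forall>v\<in>{a<..<b}. g v > ereal x) \<and> (\<forall>v\<in>{b<..<u}. g v = ereal x) \<and>
           (\<forall>v\<in>{u<..<c}. g v < ereal x))}"

text \<open>
  The crossing set records every change of sign of \<open>g - x\<close>: on an interval free of crossing points
  the sign is weakly constant.  This can fail, because a crossing point needs an interval of strict
  sign on both sides, separated by an exactly flat piece; it misses sign changes across a Cantor
  set, or across a flat piece carrying a single exceptional point.  The condition is stated almost
  everywhere because, at a common jump point of the two quantile functions, \<open>g\<close> may drop below
  both of its one-sided limits.

  If there are infinitely many crossing points listed in increasing order, then \<open>g = x\<close> almost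
  everywhere beyond all of them; this is vacuous when they tend to \<open>1\<close>.  If it fails, the
  alternating sum of the tail transforms at the crossing points diverges.
\<close>
definition crossings_complete :: "(real \<Rightarrow> ereal) \<Rightarrow> real \<Rightarrow> bool" where
  "crossings_complete g x \<longleftrightarrow>
     (\<forall>v w. 0 \<le> v \<and> v < w \<and> w \<le> 1 \<and> crossing_set g x \<inter> {v<..<w} = {} \<longrightarrow>
        (AE s in lborel. s \<in> {v<..<w} \<longrightarrow> g s \<le> ereal x) \<or>
        (AE s in lborel. s \<in> {v<..<w} \<longrightarrow> g s \<ge> ereal x)) \<and>
     (infinite (crossing_set g x) \<longrightarrow>
        (AE s in lborel. s \<in> {0<..<1} \<and> (\<forall>t\<in>crossing_set g x. t < s) \<longrightarrow> g s = ereal x))"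

text \<open>
  Terms of \<open>\<Sum>\<^sub>j\<^sub>=\<^sub>2\<^sup>N (-1)\<^sup>j f(j)\<close>, extended by \<open>0\<close> so that finite and infinite \<open>N\<close> are treated alike;
  for infinite \<open>N\<close> the sum is the limit of the partial sums.
\<close>
definition alt_term :: "enat \<Rightarrow> (nat \<Rightarrow> real) \<Rightarrow> nat \<Rightarrow> real" where
  "alt_term N f j = (if 2 \<le> j \<and> enat j \<le> N then (-1) ^ j * f j else 0)"

end

theory Submission
  imports Defs
begin

text \<open>
  Put \<open>f = g - x\<close> on \<open>(0,1)\<close> and \<open>H(t) = \<integral>\<^sub>t\<^sup>1 f\<close>.  Since a quantile function at a uniform
  argument reproduces the law of its variable, the combination \<open>\<pi>\<^sub>1(q\<^sub>1(t)) - \<lambda>\<^sub>2(q\<^sub>2(1 - t))\<close> equals \<open>H(t) - (1 - t) f(t)\<close>, so the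
  theorem concerns the alternating sum of the \<open>H(u\<^sub>j)\<close>.  By dominated convergence
  it is the integral of \<open>f\<close> over the points with an odd number of crossings to their left, and as
  the sign of \<open>f\<close> alternates between consecutive crossings, that is the integral of the positive part
  of \<open>f\<close>, or minus that of the negative part, according to the sign of \<open>f\<close> before \<open>u\<^sub>1\<close>.

  For infinitely many crossings the two series must also converge separately.  The number
  \<open>|f(u\<^sub>j)|\<close> is at most the jump at \<open>u\<^sub>j\<close> of the increasing integrable function
  \<open>q\<^sub>1(s) - q\<^sub>2(1 - s)\<close>, so the series of the \<open>(1 - u\<^sub>j) f(u\<^sub>j)\<close> converges absolutely.
\<close>

subsection \<open>Integration over the open unit interval\<close>

text \<open>The open interval keeps away from 0 and 1, where quantiles may be infinite, and matches
  the uniform law used by \<open>distr_I_eq_M\<close>.\<close>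

definition unit_measure :: "real measure" where
  "unit_measure = restrict_space lborel {0<..<1}"

lemma space_unit_measure [simp]: "space unit_measure = {0<..<1}"
  by (simp add: unit_measure_def space_restrict_space)

lemma sets_unit_measure [measurable_cong]: "sets unit_measure = sets (restrict_space borel {0<..<1})"
  unfolding unit_measure_def by (rule sets_restrict_space_cong) simp

lemma borel_measurable_unit_measure: "f \<in> borel_measurable borel \<Longrightarrow> f \<in> borel_measurable unit_measure"
  unfolding unit_measure_def by (intro measurable_restrict_space1) simp

lemma prob_space_unit_measure: "prob_space unit_measure"
  by (auto simp: unit_measure_def emeasure_restrict_space space_restrict_space intro!: prob_spaceI)

lemma measure_unit_measure [simp]: "measure unit_measure {0<..<1} = 1"
  using prob_space.prob_space[OF prob_space_unit_measure] by simp

lemma AE_unit_measure_iff: "(AE s in unit_measure. Q s) \<longleftrightarrow> (AE s in lborel. s \<in> {0<..<1} \<longrightarrow> Q s)"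
  unfolding unit_measure_def by (rule AE_restrict_space_iff) simp

lemma integrable_unit_measure:
  fixes f :: "real \<Rightarrow> real"
  shows "integrable unit_measure f \<longleftrightarrow> integrable lborel (\<lambda>s. indicator {0<..<1} s * f s)"
  unfolding unit_measure_def by (subst integrable_restrict_space) auto

lemma integral_unit_measure:
  fixes f :: "real \<Rightarrow> real"
  shows "integral\<^sup>L unit_measure f = (\<integral>s. indicator {0<..<1} s * f s \<partial>lborel)"
  unfolding unit_measure_def by (subst integral_restrict_space) auto

text \<open>Needed because the quantile of the second variable enters \<open>g\<close> at the
  reflected argument 1 - s.\<close>

lemma unit_measure_reflect:
  fixes f :: "real \<Rightarrow> real"
  shows integrable_unit_measure_reflect:
      "integrable unit_measure f \<Longrightarrow> integrable unit_measure (\<lambda>s. f (1 - s))"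
    and integral_unit_measure_reflect: "(\<integral>s. f (1 - s) \<partial>unit_measure) = integral\<^sup>L unit_measure f"
proof -
  have ind: "indicator {0<..<1} (1 - s) = (indicator {0<..<1} s :: real)" for s :: real
    by (auto split: split_indicator)
  show "integrable unit_measure f \<Longrightarrow> integrable unit_measure (\<lambda>s. f (1 - s))"
    unfolding integrable_unit_measure
    using lborel_integrable_real_affine[of "\<lambda>s. indicator {0<..<1} s * f s" "-1" 1]
    by (simp add: ind)
  show "(\<integral>s. f (1 - s) \<partial>unit_measure) = integral\<^sup>L unit_measure f"
    unfolding integral_unit_measure
    using lborel_integral_real_affine[of "-1" "\<lambda>s. indicator {0<..<1} s * f s" 1]
    by (simp add: ind)
qed

lemma integral_unit_measure_greaterThan:
  assumes "0 \<le> t" "t \<le> 1"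
  shows "(\<integral>s. indicator {t<..} s \<partial>unit_measure) = 1 - t"
proof -
  have "(\<integral>s. indicator {t<..} s \<partial>unit_measure) = (\<integral>s. indicator {t<..<1} s \<partial>lborel :: real)"
    unfolding integral_unit_measure
    by (rule Bochner_Integration.integral_cong) (use assms in \<open>auto split: split_indicator\<close>)
  then show ?thesis using assms by simp
qed

text \<open>Lets a strict sign on an interval refute an opposite weak sign that is known only almost
  everywhere.\<close>

lemma not_AE_greaterThanLessThan_False:
  fixes a b :: real
  assumes "a < b"
  shows "\<not> (AE s in lborel. s \<notin> {a<..<b})"
proof
  assume "AE s in lborel. s \<notin> {a<..<b}"
  then have "emeasure lborel {a<..<b} = 0"
    by (subst (asm) AE_iff_measurable[of "{a<..<b}"]) auto
  then show False using assms by simp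
qed

subsection \<open>Quantile functions\<close>

context
  fixes M :: "'a measure" and X :: "'a \<Rightarrow> real"
  assumes M: "prob_space M" and X [measurable]: "X \<in> borel_measurable M"
begin

lemma cdf_distribution_distr: "cdf_distribution (distr M borel X)"
  unfolding cdf_distribution_def by (rule prob_space.real_distribution_distr[OF M X])

text \<open>The Galois connection \<open>pseudoinverse\<close> between cdf and real infimum shows
  that the infimum is attained, hence finite and equal to the extended one.\<close>

lemma quantile_eq_Inf:
  assumes "0 < p" "p < 1"
  shows "quantile M X p = ereal (Inf {y. p \<le> cdf (distr M borel X) y})"
proof -
  interpret cdf_distribution "distr M borel X" by (rule cdf_distribution_distr)
  have "Inf (ereal ` {y. p \<le> C y}) = ereal (I p)"
  proof (rule antisym)
    have "p \<le> C (I p)" by (rule pseudoinverse[THEN iffD2, OF assms order_refl])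
    then show "Inf (ereal ` {y. p \<le> C y}) \<le> ereal (I p)" by (intro INF_lower) blast
    have "ereal (I p) \<le> ereal y" if "p \<le> C y" for y
      using pseudoinverse[THEN iffD1, OF assms that] by (simp only: ereal_less_eq)
    then show "ereal (I p) \<le> Inf (ereal ` {y. p \<le> C y})"
      by (intro INF_greatest) blast
  qed
  then show ?thesis by (simp add: quantile_def)
qed

lemma quantile_nonpos:
  assumes "p \<le> 0"
  shows "quantile M X p = -\<infinity>"
proof -
  have "{y. p \<le> cdf (distr M borel X) y} = UNIV"
    using assms by (auto simp: cdf_def intro: order_trans)
  moreover have "Inf (range ereal) \<le> ereal r" for r by (rule INF_lower) simp
  ultimately show ?thesis
    unfolding quantile_def by (metis (no_types) ereal_bot)
qed

lemma mono_on_quantile: "mono_on {0<..<1} (\<lambda>p. real_of_ereal (quantile M X p))"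
proof -
  interpret cdf_distribution "distr M borel X" by (rule cdf_distribution_distr)
  show ?thesis
    using mono_I by (auto simp: mono_on_def quantile_eq_Inf)
qed

lemma measurable_quantile: "(\<lambda>p. real_of_ereal (quantile M X p)) \<in> borel_measurable unit_measure"
  using borel_measurable_mono_on_fnc[OF mono_on_quantile] by (simp only: measurable_cong_sets[OF sets_unit_measure refl])

text \<open>Inverse transform sampling; through it every expectation below becomes an integral over
  the unit interval.\<close>

lemma distr_quantile: "distr unit_measure borel (\<lambda>p. real_of_ereal (quantile M X p)) = distr M borel X"
proof -
  interpret cdf_distribution "distr M borel X" by (rule cdf_distribution_distr)
  have "distr unit_measure borel (\<lambda>p. real_of_ereal (quantile M X p)) = distr unit_measure borel I"
    by (rule distr_cong) (auto simp: quantile_eq_Inf)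
  then show ?thesis by (simp add: unit_measure_def distr_I_eq_M)
qed

lemma integral_quantile:
  fixes h :: "real \<Rightarrow> real"
  assumes h [measurable]: "h \<in> borel_measurable borel"
  shows "(\<integral>\<omega>. h (X \<omega>) \<partial>M) = (\<integral>p. h (real_of_ereal (quantile M X p)) \<partial>unit_measure)"
proof -
  have "(\<integral>\<omega>. h (X \<omega>) \<partial>M) = integral\<^sup>L (distr M borel X) h"
    by (simp add: integral_distr)
  also have "\<dots> = (\<integral>p. h (real_of_ereal (quantile M X p)) \<partial>unit_measure)"
    unfolding distr_quantile[symmetric] by (rule integral_distr) (auto intro: measurable_quantile)
  finally show ?thesis .
qed

text \<open>A variable is the difference of its two tail payoffs at level 0, so finite tail
  transforms make it integrable.\<close>

lemma integrable_quantile: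
  assumes "finite_tail_transforms M X"
  shows "integrable unit_measure (\<lambda>p. real_of_ereal (quantile M X p))"
proof -
  have "integrable M (\<lambda>\<omega>. max (X \<omega> - 0) 0 - max (0 - X \<omega>) 0)"
    using assms unfolding finite_tail_transforms_def by (intro Bochner_Integration.integrable_diff) blast+
  also have "(\<lambda>\<omega>. max (X \<omega> - 0) 0 - max (0 - X \<omega>) 0) = X" by auto
  finally have "integrable (distr M borel X) (\<lambda>x. x)" by (simp add: integrable_distr_eq)
  then show ?thesis
    unfolding distr_quantile[symmetric] by (subst (asm) integrable_distr_eq) (auto intro: measurable_quantile)
qed

text \<open>By monotonicity the payoff at level \<open>q t\<close> is \<open>q s - q t\<close> to
  the right of \<open>t\<close> and 0 elsewhere. A flat piece of \<open>q\<close> around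
  \<open>t\<close> does no harm, since the difference vanishes on it.\<close>

lemma upper_tail_quantile:
  assumes t: "0 < t" "t < 1"
  defines "q \<equiv> \<lambda>p. real_of_ereal (quantile M X p)"
  shows "upper_tail M X (q t) = (\<integral>s. indicator {t<..} s * (q s - q t) \<partial>unit_measure)"
proof -
  have "upper_tail M X (q t) = (\<integral>s. max (q s - q t) 0 \<partial>unit_measure)"
    unfolding upper_tail_def q_def by (rule integral_quantile) measurable
  also have "\<dots> = (\<integral>s. indicator {t<..} s * (q s - q t) \<partial>unit_measure)"
    using mono_on_quantile t
    by (intro Bochner_Integration.integral_cong) (auto simp: q_def mono_on_def max_def split: split_indicator
          intro!: antisym)
  finally show ?thesis .
qed

lemma lower_tail_quantile:
  assumes t: "0 < t" "t < 1"
  defines "q \<equiv> \<lambda>p. real_of_ereal (quantile M X p)"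
  shows "lower_tail M X (q t) = (\<integral>s. indicator {..<t} s * (q t - q s) \<partial>unit_measure)"
proof -
  have "lower_tail M X (q t) = (\<integral>s. max (q t - q s) 0 \<partial>unit_measure)"
    unfolding lower_tail_def q_def by (rule integral_quantile) measurable
  also have "\<dots> = (\<integral>s. indicator {..<t} s * (q t - q s) \<partial>unit_measure)"
    using mono_on_quantile t
    by (intro Bochner_Integration.integral_cong) (auto simp: q_def mono_on_def max_def split: split_indicator
          intro!: antisym)
  finally show ?thesis .
qed

end

subsection \<open>Alternating sums of tail integrals\<close>

lemma alternating_prefix_sum: "(\<Sum>i<k. (-1) ^ i) = (if odd k then 1 else 0 :: real)"
proof (induction k)
  case (Suc k)
  then show ?case by (cases "even k") simp_all
qed simp

text \<open>
  When every \<open>v i\<close> lies below \<open>s\<close> the set on the right is infinite and its cardinality is the junk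
  value \<open>0\<close>; the factor \<open>f s\<close> vanishes there.
\<close>
lemma sums_alternating_tail_integrals:
  fixes f :: "real \<Rightarrow> real" and v :: "nat \<Rightarrow> real"
  assumes f: "integrable unit_measure f" and v: "incseq v"
    and beyond: "AE s in unit_measure. (\<forall>i. v i < s) \<longrightarrow> f s = 0"
  shows "(\<lambda>i. (-1) ^ i * (\<integral>s. indicator {v i<..} s * f s \<partial>unit_measure)) sums
           (\<integral>s. (if odd (card {i. v i < s}) then f s else 0) \<partial>unit_measure)"
proof -
  have [measurable]: "f \<in> borel_measurable unit_measure" using f by auto
  have ind_meas [measurable]: "indicator {t<..} \<in> borel_measurable unit_measure" for t :: real
    by (rule borel_measurable_unit_measure) auto
  have int: "integrable unit_measure (\<lambda>s. indicator {v i<..} s * f s)" for i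
    by (rule Bochner_Integration.integrable_bound[OF f]) (auto split: split_indicator)
  define K where "K s = card {i. v i < s}" for s
  define W where "W = (\<lambda>n s. \<Sum>i<n. (-1) ^ i * (indicator {v i<..} s * f s))"
  \<comment> \<open>As \<open>v\<close> is increasing, the indices below \<open>s\<close> form an
    initial segment of length \<open>K s\<close>.\<close>
  have prefix: "v i < s \<longleftrightarrow> i < K s" if "\<not> (\<forall>i. v i < s)" for i s
  proof -
    from that have "\<exists>i. s \<le> v i" by (auto simp: not_less)
    then obtain m where m: "s \<le> v m" "\<And>i. i < m \<Longrightarrow> \<not> s \<le> v i"
      using exists_least_iff[of "\<lambda>i. s \<le> v i"] by blast
    have *: "v i < s \<longleftrightarrow> i < m" for i
      using m(1) m(2)[of i] incseqD[OF v, of m i] by (cases "i < m") auto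
    have "K s = m" unfolding K_def * by simp
    then show ?thesis by (simp only: *)
  qed
  have W: "W n s = (\<Sum>i | i < n \<and> v i < s. (-1) ^ i) * f s" for n s
  proof -
    have "W n s = (\<Sum>i<n. (if v i < s then (-1) ^ i else 0) * f s)"
      unfolding W_def by (rule sum.cong) (auto split: split_indicator)
    also have "\<dots> = (\<Sum>i<n. (if v i < s then (-1) ^ i else 0)) * f s"
      by (simp add: sum_distrib_right)
    also have "(\<Sum>i<n. (if v i < s then (-1) ^ i else 0 :: real)) = (\<Sum>i | i < n \<and> v i < s. (-1) ^ i)"
      by (rule sum.mono_neutral_cong_right) auto
    finally show ?thesis .
  qed
  have W_eq: "W n s = (if odd (min n (K s)) then f s else 0)" if "\<not> (\<forall>i. v i < s)" for n s
  proof -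
    have "{i. i < n \<and> v i < s} = {..<min n (K s)}"
      by (intro set_eqI) (simp only: prefix[OF that] mem_Collect_eq lessThan_iff min_less_iff_conj)
    then have "W n s = (if odd (min n (K s)) then 1 else 0) * f s"
      by (simp only: W alternating_prefix_sum)
    then show ?thesis by (cases "odd (min n (K s))") simp_all
  qed
  have W_tendsto: "(\<lambda>n. W n s) \<longlonglongrightarrow> (if odd (K s) then f s else 0)" if "\<not> (\<forall>i. v i < s)" for s
  proof (rule tendsto_eventually)
    show "eventually (\<lambda>n. W n s = (if odd (K s) then f s else 0)) sequentially"
      using eventually_ge_at_top[of "K s"]
      by eventually_elim (simp only: W_eq[OF that] min_absorb2)
  qed
  have "(\<lambda>n. integral\<^sup>L unit_measure (W n)) \<longlonglongrightarrow>
      (\<integral>s. (if odd (K s) then f s else 0) \<partial>unit_measure)"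
  \<comment> \<open>The alternating signs cancel in pairs, so each \<open>W n s\<close> is 0 or
    \<open>f s\<close>, and |f| is an integrable majorant.\<close>
  proof (rule integral_dominated_convergence[where w = "\<lambda>s. \<bar>f s\<bar>"])
    show W_meas [measurable]: "W n \<in> borel_measurable unit_measure" for n
      unfolding W_def by (intro borel_measurable_sum borel_measurable_times ind_meas) auto
    have [measurable]: "Measurable.pred unit_measure (\<lambda>s. v i < s)" for i
      unfolding unit_measure_def by (intro measurable_restrict_space1) measurable
    show "(\<lambda>s. if odd (K s) then f s else 0) \<in> borel_measurable unit_measure"
    \<comment> \<open>At a point beyond all \<open>v i\<close> the sequence \<open>W n s\<close> may
      oscillate, while the limit function has the value 0 there because the infinite set has
      cardinality 0. Replacing \<open>W\<close> by 0 at such points gives convergence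
      everywhere.\<close>
    proof (rule borel_measurable_LIMSEQ_real)
      show "(\<lambda>s. if \<forall>i. v i < s then 0 else W n s) \<in> borel_measurable unit_measure" for n
        by measurable
      show "(\<lambda>n. if \<forall>i. v i < s then 0 else W n s) \<longlonglongrightarrow> (if odd (K s) then f s else 0)" for s
      proof (cases "\<forall>i. v i < s")
        case True
        then show ?thesis by (simp add: K_def)
      next
        case False
        then show ?thesis using W_tendsto[OF False] by (simp only: if_False)
      qed
    qed
    show "integrable unit_measure (\<lambda>s. \<bar>f s\<bar>)" using f by simp
    show "AE s in unit_measure. norm (W n s) \<le> \<bar>f s\<bar>" for n
      using beyond
    proof eventually_elim
      case (elim s)
      then show ?case
        using W_eq[of s n] W[of n s] by (cases "\<forall>i. v i < s") (simp_all only: mult_zero_right norm_zero abs_ge_zero real_norm_def, auto)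
    qed
    show "AE s in unit_measure. (\<lambda>n. W n s) \<longlonglongrightarrow> (if odd (K s) then f s else 0)"
      using beyond
    proof eventually_elim
      case (elim s)
      show ?case
      proof (cases "\<forall>i. v i < s")
        case True
        with elim have "f s = 0" by blast
        then show ?thesis by (simp add: W)
      qed (rule W_tendsto)
    qed
  qed
  moreover have "integral\<^sup>L unit_measure (W n) =
      (\<Sum>i<n. (-1) ^ i * (\<integral>s. indicator {v i<..} s * f s \<partial>unit_measure))" for n
    unfolding W_def by (subst Bochner_Integration.integral_sum) (auto intro!: integrable_mult_right int)
  ultimately show ?thesis unfolding sums_def K_def by simp
qed

subsection \<open>Jumps of monotone functions\<close>

text \<open>Separating points between consecutive \<open>v i\<close> cut the interval from
  \<open>t\<close> to \<open>s\<close> into pieces with one jump each, and the increments of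
  \<open>D\<close> over the pieces telescope. The number \<open>e i\<close> need only be dominated
  by every increment of \<open>D\<close> across \<open>v i\<close>.\<close>

lemma sum_jumps_le:
  fixes D :: "real \<Rightarrow> real" and e v :: "nat \<Rightarrow> real"
  assumes mono: "mono_on {0<..<1} D"
    and jump: "\<And>i s s'. i < n \<Longrightarrow> 0 < s' \<Longrightarrow> s' < v i \<Longrightarrow> v i < s \<Longrightarrow> s < 1 \<Longrightarrow> e i \<le> D s - D s'"
    and v: "strict_mono_on {..<n} v" and t: "0 < t" "\<And>i. i < n \<Longrightarrow> t < v i"
    and s: "t \<le> s" "s < 1" "\<And>i. i < n \<Longrightarrow> v i < s"
  shows "(\<Sum>i<n. e i) \<le> D s - D t"
  using jump v t s
proof (induction n arbitrary: s)
  case 0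
  then show ?case using monotone_onD[OF mono, of t s] by simp
next
  case (Suc n)
  \<comment> \<open>The separator must exceed all earlier points and stay below \<open>v n\<close>:
    a midpoint does, or \<open>t\<close> itself if there is no earlier point.\<close>
  define s' where "s' = (if n = 0 then t else (v (n - 1) + v n) / 2)"
  have lt: "v (n - 1) < v n" if "n \<noteq> 0"
    using strict_mono_onD[OF Suc.prems(2), of "n - 1" n] that by simp
  have below: "v i \<le> v (n - 1)" if "i < n" for i
    using strict_mono_on_leD[OF Suc.prems(2), of i "n - 1"] that by simp
  have s': "t \<le> s'" "s' < v n" "\<And>i. i < n \<Longrightarrow> v i < s'"
    using lt Suc.prems(4)[of n] Suc.prems(4)[of "n - 1"] below by (force simp: s'_def)+
  have "v n < s" using Suc.prems(7) by simp
  have "(\<Sum>i<n. e i) \<le> D s' - D t"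
    using Suc.prems(1,2,3,4,6) s' \<open>v n < s\<close> by (intro Suc.IH) (auto simp: strict_mono_on_def)
  moreover have "e n \<le> D s - D s'"
    using Suc.prems(1)[of n s' s] s' Suc.prems(3,6) \<open>v n < s\<close> by simp
  ultimately show ?case by simp
qed

text \<open>
  Each jump is weighted by the length of the interval to its right, so integrating
  \<open>sum_jumps_le\<close> over its right end point bounds the weighted sum by the integral of \<open>D\<close>.
\<close>
lemma sum_weighted_jumps_le:
  fixes D :: "real \<Rightarrow> real" and e v :: "nat \<Rightarrow> real"
  assumes mono: "mono_on {0<..<1} D" and D: "integrable unit_measure D"
    and jump: "\<And>i s s'. i < n \<Longrightarrow> 0 < s' \<Longrightarrow> s' < v i \<Longrightarrow> v i < s \<Longrightarrow> s < 1 \<Longrightarrow> e i \<le> D s - D s'"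
    and v: "strict_mono_on {..<n} v" and t: "0 < t" "t < 1" "\<And>i. i < n \<Longrightarrow> t < v i" "\<And>i. i < n \<Longrightarrow> v i < 1"
  shows "(\<Sum>i<n. (1 - v i) * e i) \<le> (\<integral>s. indicator {t<..} s * (D s - D t) \<partial>unit_measure)"
proof -
  interpret prob_space unit_measure by (rule prob_space_unit_measure)
  have [measurable]: "D \<in> borel_measurable unit_measure" using D by auto
  have [measurable]: "indicator {t<..} \<in> borel_measurable unit_measure" for t :: real
    by (rule borel_measurable_unit_measure) auto
  have ind: "integrable unit_measure (indicator {r<..} :: real \<Rightarrow> real)" for r
    by (rule integrable_const_bound[where B=1]) (auto split: split_indicator)
  \<comment> \<open>The weight 1 - v i is the length of the interval to the right of
    \<open>v i\<close>, written as an integral so that the sum can be moved inside.\<close>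
  have "(\<Sum>i<n. (1 - v i) * e i) = (\<Sum>i<n. e i * (\<integral>s. indicator {v i<..} s \<partial>unit_measure))"
  proof (rule sum.cong)
    fix i assume "i \<in> {..<n}"
    then show "(1 - v i) * e i = e i * (\<integral>s. indicator {v i<..} s \<partial>unit_measure)"
      using t(1) t(3,4)[of i] by (subst integral_unit_measure_greaterThan) auto
  qed simp
  also have "\<dots> = (\<integral>s. (\<Sum>i<n. e i * indicator {v i<..} s) \<partial>unit_measure)"
    using ind by (subst Bochner_Integration.integral_sum) auto
  also have "\<dots> \<le> (\<integral>s. indicator {t<..} s * (D s - D t) \<partial>unit_measure)"
  proof (rule integral_mono)
    show "integrable unit_measure (\<lambda>s. \<Sum>i<n. e i * indicator {v i<..} s)"
      by (intro Bochner_Integration.integrable_sum integrable_mult_right ind)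
    show "integrable unit_measure (\<lambda>s. indicator {t<..} s * (D s - D t))"
      by (rule Bochner_Integration.integrable_bound[where f="\<lambda>s. D s - D t"])
        (use D in \<open>auto split: split_indicator\<close>)
    fix s assume "s \<in> space unit_measure"
    then have s: "0 < s" "s < 1" by auto
    show "(\<Sum>i<n. e i * indicator {v i<..} s) \<le> indicator {t<..} s * (D s - D t)"
    proof (cases "t < s")
      case False
      then have "\<not> v i < s" if "i < n" for i using t(3)[OF that] by auto
      then have "(\<Sum>i<n. e i * indicator {v i<..} s) = 0" by (intro sum.neutral) auto
      then show ?thesis using False by simp
    next
      case True
      \<comment> \<open>Only jumps to the left of \<open>s\<close> contribute; they form an initial
        segment, so the unweighted bound applies with \<open>m\<close> in place of
        \<open>n\<close>.\<close>
      have "\<exists>m\<le>n. {i. i < n \<and> v i < s} = {..<m}"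
      proof (cases "\<forall>i<n. v i < s")
        case True
        then show ?thesis by (intro exI[of _ n]) auto
      next
        case False
        then have "\<exists>i. i < n \<and> s \<le> v i" by (auto simp: not_less)
        then obtain k where k: "k < n" "s \<le> v k" "\<forall>i<k. \<not> (i < n \<and> s \<le> v i)"
          using exists_least_iff[of "\<lambda>i. i < n \<and> s \<le> v i"] by blast
        moreover have "v k \<le> v i" if "k \<le> i" "i < n" for i
          using strict_mono_onD[OF v, of k i] that k(1) by (cases "i = k") auto
        ultimately have "i < n \<and> v i < s \<longleftrightarrow> i < k" for i
          by (meson le_less_trans less_trans not_le order_trans)
        then show ?thesis using k(1) by (intro exI[of _ k]) auto
      qed
      then obtain m where m: "m \<le> n" "{i. i < n \<and> v i < s} = {..<m}" by blast
      then have mD: "i < m \<Longrightarrow> i < n \<and> v i < s" for i by blast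
      have "(\<Sum>i<n. e i * indicator {v i<..} s) = (\<Sum>i | i < n \<and> v i < s. e i)"
        by (rule sum.mono_neutral_cong_right) (auto split: split_indicator)
      also have "\<dots> \<le> D s - D t"
        unfolding m(2)
      proof (rule sum_jumps_le[OF mono])
        show "e i \<le> D s - D s'" if "i < m" "0 < s'" "s' < v i" "v i < s" "s < 1" for i s s'
          using jump that mD by blast
        show "strict_mono_on {..<m} v"
          using v m(1) by (auto simp: strict_mono_on_def)
      qed (use t mD s True in auto)
      finally show ?thesis using True by simp
    qed
  qed
  finally show ?thesis .
qed

subsection \<open>Sign changes\<close>

text \<open>The sign \<epsilon> is 1 for an upward and -1 for a downward crossing, so that one
  argument treats both alternatives of \<open>crossing_set\<close>.\<close>

definition crosses :: "real \<Rightarrow> (real \<Rightarrow> real) \<Rightarrow> real \<Rightarrow> bool" where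
  "crosses \<epsilon> f u \<longleftrightarrow> (\<exists>a\<ge>0. \<exists>b c. a < b \<and> b \<le> u \<and> u < c \<and> c \<le> 1 \<and>
     (\<forall>v\<in>{a<..<b}. \<epsilon> * f v < 0) \<and> (\<forall>v\<in>{b<..<u}. f v = 0) \<and> (\<forall>v\<in>{u<..<c}. \<epsilon> * f v > 0))"

definition sign_changes :: "(real \<Rightarrow> real) \<Rightarrow> real set" where
  "sign_changes f = {u \<in> {0<..<1}. \<exists>\<epsilon>\<in>{1, -1}. crosses \<epsilon> f u}"

text \<open>All intervals in the definition of a crossing lie inside (0,1), so the possibly infinite
  values of \<open>g\<close> at 0 and 1 never enter.\<close>

lemma crossing_set_eq_sign_changes:
  assumes g: "\<And>v. v \<in> {0<..<1} \<Longrightarrow> g v = ereal (f v + x)"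
  shows "crossing_set g x = sign_changes f"
proof -
  have fin: "(g v < ereal x \<longleftrightarrow> f v < 0) \<and> (g v = ereal x \<longleftrightarrow> f v = 0) \<and> (g v > ereal x \<longleftrightarrow> f v > 0)"
    if "0 < v" "v < 1" for v
    using g[of v] that by auto
  have ball: "(\<forall>v\<in>{p<..<q}. g v < ereal x) \<longleftrightarrow> (\<forall>v\<in>{p<..<q}. f v < 0)"
      "(\<forall>v\<in>{p<..<q}. g v = ereal x) \<longleftrightarrow> (\<forall>v\<in>{p<..<q}. f v = 0)"
      "(\<forall>v\<in>{p<..<q}. g v > ereal x) \<longleftrightarrow> (\<forall>v\<in>{p<..<q}. f v > 0)"
    if "0 \<le> p" "q \<le> 1" for p q
    by (rule ball_cong[OF refl], use fin that in force)+
  have "u \<in> crossing_set g x \<longleftrightarrow> u \<in> sign_changes f" if u: "0 < u" "u < 1" for u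
  proof
    assume "u \<in> crossing_set g x"
    then obtain a b c where abc: "0 \<le> a" "a < b" "b \<le> u" "u < c" "c \<le> 1" and
      "(\<forall>v\<in>{a<..<b}. g v < ereal x) \<and> (\<forall>v\<in>{b<..<u}. g v = ereal x) \<and> (\<forall>v\<in>{u<..<c}. g v > ereal x) \<or>
       (\<forall>v\<in>{a<..<b}. g v > ereal x) \<and> (\<forall>v\<in>{b<..<u}. g v = ereal x) \<and> (\<forall>v\<in>{u<..<c}. g v < ereal x)"
      unfolding crossing_set_def by auto
    then have "(\<forall>v\<in>{a<..<b}. f v < 0) \<and> (\<forall>v\<in>{b<..<u}. f v = 0) \<and> (\<forall>v\<in>{u<..<c}. f v > 0) \<or>
       (\<forall>v\<in>{a<..<b}. f v > 0) \<and> (\<forall>v\<in>{b<..<u}. f v = 0) \<and> (\<forall>v\<in>{u<..<c}. f v < 0)"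
      using ball[of a b] ball[of b u] ball[of u c] u by simp
    then have "crosses 1 f u \<or> crosses (-1) f u"
    proof
      assume *: "(\<forall>v\<in>{a<..<b}. f v < 0) \<and> (\<forall>v\<in>{b<..<u}. f v = 0) \<and> (\<forall>v\<in>{u<..<c}. f v > 0)"
      have "crosses 1 f u"
        unfolding crosses_def using abc *
        by (intro exI[of _ a] conjI exI[of _ b] exI[of _ c]) simp_all
      then show ?thesis ..
    next
      assume *: "(\<forall>v\<in>{a<..<b}. f v > 0) \<and> (\<forall>v\<in>{b<..<u}. f v = 0) \<and> (\<forall>v\<in>{u<..<c}. f v < 0)"
      have "crosses (-1) f u"
        unfolding crosses_def using abc *
        by (intro exI[of _ a] conjI exI[of _ b] exI[of _ c]) simp_all
      then show ?thesis ..
    qed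
    then show "u \<in> sign_changes f" using u by (simp add: sign_changes_def)
  next
    assume "u \<in> sign_changes f"
    then obtain \<epsilon> where \<epsilon>: "\<epsilon> \<in> {1, -1}" "crosses \<epsilon> f u" unfolding sign_changes_def by blast
    then obtain a b c where abc: "0 \<le> a" "a < b" "b \<le> u" "u < c" "c \<le> 1" and
      *: "\<forall>v\<in>{a<..<b}. \<epsilon> * f v < 0" "\<forall>v\<in>{b<..<u}. f v = 0" "\<forall>v\<in>{u<..<c}. \<epsilon> * f v > 0"
      unfolding crosses_def by blast
    have "(\<forall>v\<in>{a<..<b}. f v < 0) \<and> (\<forall>v\<in>{b<..<u}. f v = 0) \<and> (\<forall>v\<in>{u<..<c}. f v > 0) \<or>
       (\<forall>v\<in>{a<..<b}. f v > 0) \<and> (\<forall>v\<in>{b<..<u}. f v = 0) \<and> (\<forall>v\<in>{u<..<c}. f v < 0)"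
      using \<epsilon>(1) * by (elim insertE) simp_all
    then have "(\<forall>v\<in>{a<..<b}. g v < ereal x) \<and> (\<forall>v\<in>{b<..<u}. g v = ereal x) \<and> (\<forall>v\<in>{u<..<c}. g v > ereal x) \<or>
       (\<forall>v\<in>{a<..<b}. g v > ereal x) \<and> (\<forall>v\<in>{b<..<u}. g v = ereal x) \<and> (\<forall>v\<in>{u<..<c}. g v < ereal x)"
      using ball[of a b] ball[of b u] ball[of u c] u abc by simp
    then show "u \<in> crossing_set g x"
      unfolding crossing_set_def using u abc
      by (intro CollectI conjI bexI[of _ a] bexI[of _ b] bexI[of _ c]) simp_all
  qed
  then show ?thesis by (auto simp: crossing_set_def sign_changes_def)
qed

text \<open>Arbitrarily close to a crossing, values of weakly opposite sign occur on its two sides.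
  This is what bounds |f u| by the variation of \<open>f\<close> near \<open>u\<close>.\<close>

lemma sign_changes_bracket:
  assumes "u \<in> sign_changes f" "s' < u" "u < s"
  obtains p q where "s' < p" "p < u" "u < q" "q < s" "f p \<le> 0 \<and> 0 \<le> f q \<or> f q \<le> 0 \<and> 0 \<le> f p"
proof -
  obtain \<epsilon> a b c where \<epsilon>: "\<epsilon> \<in> {1, -1}" and abc: "a < b" "b \<le> u" "u < c" and
    *: "\<forall>v\<in>{a<..<b}. \<epsilon> * f v < 0" "\<forall>v\<in>{b<..<u}. f v = 0" "\<forall>v\<in>{u<..<c}. \<epsilon> * f v > 0"
    using assms(1) unfolding sign_changes_def crosses_def by blast
  obtain q where q: "u < q" "q < min c s" using dense[of u "min c s"] assms(3) abc(3) by auto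
  \<comment> \<open>Immediately to the left of \<open>u\<close> lies either the flat piece, where
    \<open>f\<close> is 0, or, if that piece is empty, the interval of strict sign.\<close>
  have "\<exists>p. s' < p \<and> p < u \<and> \<epsilon> * f p \<le> 0"
  proof (cases "b < u")
    case True
    then obtain p where "max b s' < p" "p < u" using dense[of "max b s'" u] assms(2) by auto
    then show ?thesis using *(2) by (intro exI[of _ p]) simp
  next
    case False
    then have "b = u" using abc by simp
    obtain p where "max a s' < p" "p < u" using dense[of "max a s'" u] assms(2) abc(1) \<open>b = u\<close> by auto
    then show ?thesis using *(1) \<open>b = u\<close> by (intro exI[of _ p]) (simp add: less_imp_le)
  qed
  then obtain p where p: "s' < p" "p < u" "\<epsilon> * f p \<le> 0" by blast
  have "\<epsilon> * f q > 0" using * q by simp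
  show thesis
    by (rule that[OF p(1,2) q(1)]) (use q p(3) \<open>\<epsilon> * f q > 0\<close> \<epsilon> in auto)
qed

text \<open>The strict sign immediately after \<open>u\<close> holds on a set of positive measure,
  which rules out the opposite weak sign.\<close>

lemma crosses_sign_right:
  assumes "crosses \<epsilon> f u" "u < w" and ae: "AE s in lborel. s \<in> {u<..<w} \<longrightarrow> 0 \<le> \<delta> * f s"
    and "\<epsilon> \<in> {1, -1}" "\<delta> \<in> {1, -1}"
  shows "\<delta> = \<epsilon>"
proof (rule ccontr)
  assume "\<delta> \<noteq> \<epsilon>"
  then have \<delta>: "\<delta> = - \<epsilon>" using assms(4,5) by auto
  obtain c where c: "u < c" "\<forall>v\<in>{u<..<c}. \<epsilon> * f v > 0"
    using assms(1) unfolding crosses_def by blast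
  have "AE s in lborel. s \<notin> {u<..<min c w}"
    using ae
  proof eventually_elim
    case (elim s)
    show ?case
    proof
      assume "s \<in> {u<..<min c w}"
      then have "0 < \<epsilon> * f s" "0 \<le> \<delta> * f s" using c(2) elim by auto
      then show False using \<delta> by simp
    qed
  qed
  then show False using not_AE_greaterThanLessThan_False[of u "min c w"] c(1) assms(2) by simp
qed

text \<open>Before \<open>u\<close> the strict sign may be separated from \<open>u\<close> by a long
  flat piece. The crossing at \<open>v\<close> ensures that the interval of strict sign still meets
  the gap between \<open>v\<close> and \<open>u\<close>.\<close>

lemma crosses_sign_left:
  assumes "crosses \<epsilon> f u" "v < u" and ae: "AE s in lborel. s \<in> {v<..<u} \<longrightarrow> 0 \<le> \<delta> * f s"
    and v: "crosses \<eta> f v"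
    and "\<epsilon> \<in> {1, -1}" "\<delta> \<in> {1, -1}"
  shows "\<delta> = - \<epsilon>"
proof (rule ccontr)
  assume "\<delta> \<noteq> - \<epsilon>"
  then have \<delta>: "\<delta> = \<epsilon>" using assms(5,6) by auto
  obtain a b where ab: "a < b" "b \<le> u" "\<forall>v\<in>{a<..<b}. \<epsilon> * f v < 0" "\<forall>v\<in>{b<..<u}. f v = 0"
    using assms(1) unfolding crosses_def by blast
  obtain c where c: "v < c" "\<forall>s\<in>{v<..<c}. \<eta> * f s > 0"
    using v unfolding crosses_def by blast
  \<comment> \<open>Otherwise the flat piece would reach back to \<open>v\<close> and overlap the
    interval after \<open>v\<close> on which \<open>f\<close> is nonzero.\<close>
  have "v < b"
  proof (rule ccontr)
    assume "\<not> v < b"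
    obtain s where "v < s" "s < min c u" using dense[of v "min c u"] c(1) assms(2) by auto
    then show False using c(2) ab(4) \<open>\<not> v < b\<close> by force
  qed
  have "AE s in lborel. s \<notin> {max a v<..<b}"
    using ae
  proof eventually_elim
    case (elim s)
    show ?case
    proof
      assume "s \<in> {max a v<..<b}"
      then have "\<epsilon> * f s < 0" "0 \<le> \<delta> * f s" using ab(2,3) elim by auto
      then show False using \<delta> by simp
    qed
  qed
  then show False using not_AE_greaterThanLessThan_False[of "max a v" b] ab(1) \<open>v < b\<close> by simp
qed

lemma crosses_sign_first:
  assumes "crosses \<epsilon> f u" "\<forall>s\<in>{0<..<u}. \<delta> * f s \<le> 0"
    and "\<epsilon> \<in> {1, -1}" "\<delta> \<in> {1, -1}"
  shows "\<delta> = \<epsilon>"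
proof (rule ccontr)
  assume "\<delta> \<noteq> \<epsilon>"
  then have \<delta>: "\<delta> = - \<epsilon>" using assms(3,4) by auto
  obtain a b where ab: "0 \<le> a" "a < b" "b \<le> u" "\<forall>v\<in>{a<..<b}. \<epsilon> * f v < 0"
    using assms(1) unfolding crosses_def by blast
  obtain s where "a < s" "s < b" using dense ab(2) by blast
  then have "\<epsilon> * f s < 0" "\<delta> * f s \<le> 0" using assms(2) ab by auto
  then show False using \<delta> by simp
qed

text \<open>The number \<open>T\<close> is the integral of \<open>f\<close> over the points with an
  odd number of crossings to their left. It is fixed before the sign \<sigma>, so the same value
  serves both cases of the theorem.\<close>

lemma alternating_sign_changes:
  fixes f :: "real \<Rightarrow> real" and u :: "nat \<Rightarrow> real" and N :: enat
  defines "H \<equiv> \<lambda>t. \<integral>s. indicator {t<..} s * f s \<partial>unit_measure"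
  assumes f: "integrable unit_measure f"
    and N: "1 \<le> N" and u_mono: "strict_mono_on {j. 1 \<le> j \<and> enat j \<le> N} u"
    and u_range: "u ` {j. 1 \<le> j \<and> enat j \<le> N} = sign_changes f"
    and complete: "\<And>v w. 0 \<le> v \<Longrightarrow> v < w \<Longrightarrow> w \<le> 1 \<Longrightarrow> sign_changes f \<inter> {v<..<w} = {} \<Longrightarrow>
        \<exists>\<delta>\<in>{1, -1}. AE s in lborel. s \<in> {v<..<w} \<longrightarrow> 0 \<le> \<delta> * f s"
    and beyond: "infinite (sign_changes f) \<Longrightarrow>
        AE s in lborel. s \<in> {0<..<1} \<and> (\<forall>t\<in>sign_changes f. t < s) \<longrightarrow> f s = 0"
  obtains T where "alt_term N (\<lambda>j. H (u j)) sums (H (u 1) - T)"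
    and "\<And>\<sigma>. \<sigma> \<in> {1, -1} \<Longrightarrow> \<forall>s\<in>{0<..<u 1}. \<sigma> * f s \<le> 0 \<Longrightarrow>
           \<sigma> * T = (\<integral>s. max (\<sigma> * f s) 0 \<partial>unit_measure)"
proof -
  have u_in: "u j \<in> sign_changes f" if "1 \<le> j" "enat j \<le> N" for j
    using u_range that by blast
  then have u01: "0 < u j" "u j < 1" if "1 \<le> j" "enat j \<le> N" for j
    using that by (auto simp: sign_changes_def)
  have enat_le: "enat i \<le> N" if "enat j \<le> N" "i \<le> j" for i j
    using that order_trans[of "enat i" "enat j" N] by simp
  \<comment> \<open>Indexing from 0 and padding with 1 turns finite and infinite \<open>N\<close>
    alike into one increasing sequence; the padding contributes nothing because
    \<open>H 1 = 0\<close>.\<close>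
  define v where "v i = (if enat (Suc i) \<le> N then u (Suc i) else 1)" for i
  have v0: "v 0 = u 1" using N by (simp add: v_def one_enat_def)
  have v01: "0 < v i" "v i \<le> 1" for i using u01[of "Suc i"] by (auto simp: v_def)
  have u_less: "u i < u j" if "1 \<le> i" "i < j" "enat j \<le> N" for i j
    using strict_mono_onD[OF u_mono, of i j] that enat_le[of j i] by simp
  have v_less: "v i < v (Suc i)" if "enat (Suc i) \<le> N" for i
    using u_less[of "Suc i" "Suc (Suc i)"] u01[of "Suc i"] that by (simp add: v_def)
  have v: "incseq v"
  proof (rule incseq_SucI)
    fix i
    show "v i \<le> v (Suc i)"
    proof (cases "enat (Suc i) \<le> N")
      case False
      then have "\<not> enat (Suc (Suc i)) \<le> N" using enat_le[of "Suc (Suc i)" "Suc i"] by auto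
      then show ?thesis using False by (simp add: v_def)
    qed (use v_less in \<open>auto intro: less_imp_le\<close>)
  qed
  \<comment> \<open>With finitely many crossings some \<open>v i\<close> equals 1 and no point of
    (0,1) lies beyond it; otherwise \<open>beyond\<close> applies.\<close>
  have v_beyond: "AE s in unit_measure. (\<forall>i. v i < s) \<longrightarrow> f s = 0"
  proof (cases "\<exists>i. \<not> enat (Suc i) \<le> N")
    case True
    then obtain i where "\<not> enat (Suc i) \<le> N" by blast
    then have "v i = 1" by (simp add: v_def)
    then show ?thesis unfolding AE_unit_measure_iff by (intro AE_I2) (auto dest: spec[of _ i])
  next
    case False
    then have all: "enat (Suc i) \<le> N" for i by blast
    have "inj (\<lambda>i. u (Suc i))"
      using u_less all by (intro linorder_injI) (metis One_nat_def Suc_le_mono Suc_less_eq le0 less_irrefl)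
    then have "infinite (range (\<lambda>i. u (Suc i)))" by (simp add: range_inj_infinite)
    moreover have "range (\<lambda>i. u (Suc i)) \<subseteq> sign_changes f" using u_in all by auto
    ultimately have "infinite (sign_changes f)" using finite_subset by blast
    from beyond[OF this] show ?thesis
      unfolding AE_unit_measure_iff
    proof eventually_elim
      case (elim s)
      show ?case
      proof (intro impI)
        assume s: "s \<in> {0<..<1}" "\<forall>i. v i < s"
        have "t < s" if "t \<in> sign_changes f" for t
        proof -
          obtain j where "1 \<le> j" "t = u j" using \<open>t \<in> sign_changes f\<close> u_range by blast
          then have "t = v (j - 1)" using all[of "j - 1"] by (simp add: v_def)
          then show ?thesis using s by blast
        qed
        then show "f s = 0" using elim s by blast
      qed
    qed
  qed
  define K where "K s = card {i. v i < s}" for s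
  define T where "T = (\<integral>s. (if odd (K s) then f s else 0) \<partial>unit_measure)"
  have T: "(\<lambda>i. (-1) ^ i * H (v i)) sums T"
    unfolding T_def K_def H_def by (rule sums_alternating_tail_integrals[OF f v v_beyond])
  have H1: "H 1 = 0"
  proof -
    have "H 1 = (\<integral>s. 0 \<partial>unit_measure)"
      unfolding H_def by (rule Bochner_Integration.integral_cong) auto
    then show ?thesis by simp
  qed
  show thesis
  proof (rule that)
    \<comment> \<open>Splitting off the term of \<open>u 1\<close> and changing signs matches (-1)^j
      with j = i + 2; the terms of \<open>alt_term\<close> at 0 and 1 are 0.\<close>
    have "(\<lambda>i. - ((-1) ^ Suc i * H (v (Suc i)))) sums (- (T - (-1) ^ 0 * H (v 0)))"
      by (rule sums_minus, subst sums_Suc_iff) (use T in simp)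
    also have "(\<lambda>i. - ((-1) ^ Suc i * H (v (Suc i)))) = (\<lambda>i. alt_term N (\<lambda>j. H (u j)) (Suc (Suc i)))"
      by (auto simp: alt_term_def v_def H1)
    finally show "alt_term N (\<lambda>j. H (u j)) sums (H (u 1) - T)"
      by (subst (asm) sums_Suc_iff, subst (asm) sums_Suc_iff) (simp add: alt_term_def v0)
  next
    fix \<sigma> :: real
    assume \<sigma>: "\<sigma> \<in> {1, -1}" and first: "\<forall>s\<in>{0<..<u 1}. \<sigma> * f s \<le> 0"
    have \<sigma>_alt: "\<sigma> * (-1) ^ i \<in> {1, -1}" for i using \<sigma> by (cases "even i") auto
    have gap: "\<exists>\<delta>\<in>{1, -1}. AE s in lborel. s \<in> {v i<..<v (Suc i)} \<longrightarrow> 0 \<le> \<delta> * f s"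
      if i: "enat (Suc i) \<le> N" for i
    proof (rule complete)
      show "sign_changes f \<inter> {v i<..<v (Suc i)} = {}"
      proof (rule ccontr)
        assume "sign_changes f \<inter> {v i<..<v (Suc i)} \<noteq> {}"
        then obtain j where j: "1 \<le> j" "enat j \<le> N" "v i < u j" "u j < v (Suc i)"
          unfolding u_range[symmetric] by auto
        have "Suc i < j"
        proof (rule ccontr)
          assume "\<not> Suc i < j"
          then have "u j \<le> u (Suc i)" using u_less[of j "Suc i"] j i by (cases "j = Suc i") auto
          then show False using j i by (simp add: v_def)
        qed
        then have "enat (Suc (Suc i)) \<le> N" using j(2) enat_le by simp
        moreover have "u (Suc (Suc i)) \<le> u j"
          using u_less[of "Suc (Suc i)" j] \<open>Suc i < j\<close> j by (cases "j = Suc (Suc i)") auto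
        ultimately show False using j(4) by (simp add: v_def)
      qed
    qed (use v01 v_less[OF i] less_imp_le in auto)
    have cross: "\<exists>\<epsilon>\<in>{1, -1}. crosses \<epsilon> f (v i)" if "enat (Suc i) \<le> N" for i
      using u_in[of "Suc i"] that by (auto simp: v_def sign_changes_def)
    \<comment> \<open>Directions alternate: the crossing at \<open>v i\<close> fixes the sign of
      \<open>f\<close> on the following gap, and that sign fixes the direction at the end of the
      gap.\<close>
    have signs: "crosses (\<sigma> * (-1) ^ i) f (v i)" if "enat (Suc i) \<le> N" for i
      using that
    proof (induction i)
      case 0
      then obtain \<epsilon> where \<epsilon>: "\<epsilon> \<in> {1, -1}" "crosses \<epsilon> f (v 0)" using cross by blast
      then show ?case using crosses_sign_first[OF \<epsilon>(2), of \<sigma>] first \<sigma> by (simp add: v0)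
    next
      case (Suc i)
      then have i: "enat (Suc i) \<le> N" using enat_le by simp
      obtain \<delta> where \<delta>: "\<delta> \<in> {1, -1}" "AE s in lborel. s \<in> {v i<..<v (Suc i)} \<longrightarrow> 0 \<le> \<delta> * f s"
        using gap[OF i] by blast
      obtain \<epsilon> where \<epsilon>: "\<epsilon> \<in> {1, -1}" "crosses \<epsilon> f (v (Suc i))" using cross Suc.prems by blast
      have "\<delta> = \<sigma> * (-1) ^ i"
        by (rule crosses_sign_right[OF Suc.IH[OF i] v_less[OF i] \<delta>(2) \<sigma>_alt \<delta>(1)])
      moreover have "\<delta> = - \<epsilon>"
        by (rule crosses_sign_left[OF \<epsilon>(2) v_less[OF i] \<delta>(2) Suc.IH[OF i] \<epsilon>(1) \<delta>(1)])
      ultimately have "\<epsilon> = \<sigma> * (-1) ^ Suc i" by simp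
      then show ?case using \<epsilon>(2) by (simp only:)
    qed
    \<comment> \<open>Thanks to the padding this includes the gap between a last crossing and
      1.\<close>
    have "AE s in lborel. enat (Suc i) \<le> N \<longrightarrow> s \<in> {v i<..<v (Suc i)} \<longrightarrow> 0 \<le> \<sigma> * (-1) ^ i * f s" for i
    proof (cases "enat (Suc i) \<le> N")
      case True
      then obtain \<delta> where \<delta>: "\<delta> \<in> {1, -1}" "AE s in lborel. s \<in> {v i<..<v (Suc i)} \<longrightarrow> 0 \<le> \<delta> * f s"
        using gap by blast
      have "\<delta> = \<sigma> * (-1) ^ i"
        by (rule crosses_sign_right[OF signs[OF True] v_less[OF True] \<delta>(2) \<sigma>_alt \<delta>(1)])
      then show ?thesis using \<delta>(2) by simp
    qed simp
    then have "AE s in lborel. \<forall>i. enat (Suc i) \<le> N \<longrightarrow> s \<in> {v i<..<v (Suc i)} \<longrightarrow> 0 \<le> \<sigma> * (-1) ^ i * f s"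
      by (simp only: AE_all_countable) blast
    moreover have "AE s in lborel. \<forall>i. s \<noteq> v i"
      using AE_lborel_singleton by (simp only: AE_all_countable) blast
    moreover note v_beyond[unfolded AE_unit_measure_iff]
    ultimately have "AE s in lborel. s \<in> {0<..<1} \<longrightarrow> \<sigma> * (if odd (K s) then f s else 0) = max (\<sigma> * f s) 0"
    proof eventually_elim
      case (elim s)
      show ?case
      proof
        assume s: "s \<in> {0<..<1}"
        show "\<sigma> * (if odd (K s) then f s else 0) = max (\<sigma> * f s) 0"
        proof (cases "\<forall>i. v i < s")
          case True
          then have "f s = 0" using elim s by blast
          then show ?thesis by simp
        next
          case False
          then have "\<exists>i. s \<le> v i" by (auto simp: not_less)
          then obtain m where m: "s \<le> v m" "\<And>i. i < m \<Longrightarrow> \<not> s \<le> v i"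
            using exists_least_iff[of "\<lambda>i. s \<le> v i"] by blast
          have *: "v i < s \<longleftrightarrow> i < m" for i
            using m(1) m(2)[of i] incseqD[OF v, of m i] by (cases "i < m") auto
          have K: "K s = m" unfolding K_def * by simp
          have "s < v m" using m(1) elim(2) by (metis order_le_less)
          \<comment> \<open>Here \<open>m\<close> counts the crossings to the left of
            \<open>s\<close>: \<sigma> * f s is nonpositive for even \<open>m\<close> and
            nonnegative for odd \<open>m\<close>.\<close>
          show ?thesis
          proof (cases m)
            case 0
            then have "\<sigma> * f s \<le> 0" using first s \<open>s < v m\<close> v0 by simp
            then show ?thesis using 0 K by simp
          next
            case (Suc k)
            then have k: "v k < s" using * by simp
            then have "enat (Suc k) \<le> N" using s by (auto simp: v_def split: if_splits)
            then have "0 \<le> \<sigma> * (-1) ^ k * f s" using elim(1) k \<open>s < v m\<close> Suc by simp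
            then show ?thesis using K Suc by (cases "even k") auto
          qed
        qed
      qed
    qed
    then have ae: "AE s in unit_measure. \<sigma> * (if odd (K s) then f s else 0) = max (\<sigma> * f s) 0"
      unfolding AE_unit_measure_iff .
    have [measurable]: "f \<in> borel_measurable unit_measure" using f by auto
    have [measurable]: "Measurable.pred unit_measure (\<lambda>s. v i < s)" for i
      unfolding unit_measure_def by (intro measurable_restrict_space1) measurable
    have "(\<lambda>s. if odd (K s) then f s else 0) \<in> borel_measurable unit_measure"
      unfolding K_def by (rule measurable_If) measurable
    then have "(\<lambda>s. \<sigma> * (if odd (K s) then f s else 0)) \<in> borel_measurable unit_measure"
      by (intro borel_measurable_times) auto
    then have "(\<integral>s. \<sigma> * (if odd (K s) then f s else 0) \<partial>unit_measure) = (\<integral>s. max (\<sigma> * f s) 0 \<partial>unit_measure)"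
      by (intro integral_cong_AE ae) auto
    then show "\<sigma> * T = (\<integral>s. max (\<sigma> * f s) 0 \<partial>unit_measure)"
      unfolding T_def by simp
  qed
qed

subsection \<open>Tail transforms of quantile functions\<close>

text \<open>Put-call parity: the two payoffs differ by X - r.\<close>

lemma upper_tail_minus_lower_tail:
  assumes M: "prob_space M" and X [measurable]: "X \<in> borel_measurable M"
    and fin: "finite_tail_transforms M X"
  shows "upper_tail M X r - lower_tail M X r = integral\<^sup>L unit_measure (\<lambda>p. real_of_ereal (quantile M X p)) - r"
proof -
  interpret prob_space unit_measure by (rule prob_space_unit_measure)
  interpret M: prob_space M by (rule M)
  have int: "integrable M (\<lambda>\<omega>. max (X \<omega> - r) 0)" "integrable M (\<lambda>\<omega>. max (r - X \<omega>) 0)"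
    using fin unfolding finite_tail_transforms_def by blast+
  have "upper_tail M X r - lower_tail M X r = (\<integral>\<omega>. max (X \<omega> - r) 0 - max (r - X \<omega>) 0 \<partial>M)"
    unfolding upper_tail_def lower_tail_def by (rule Bochner_Integration.integral_diff[OF int, symmetric])
  also have "(\<lambda>\<omega>. max (X \<omega> - r) 0 - max (r - X \<omega>) 0) = (\<lambda>\<omega>. X \<omega> - r)" by auto
  also have "(\<integral>\<omega>. X \<omega> - r \<partial>M) = (\<integral>p. real_of_ereal (quantile M X p) - r \<partial>unit_measure)"
    by (rule integral_quantile[OF M X]) measurable
  also have "\<dots> = integral\<^sup>L unit_measure (\<lambda>p. real_of_ereal (quantile M X p)) - r"
    using integrable_quantile[OF M X fin] by simp
  finally show ?thesis .
qed

section \<open>Tail transforms of two quantiles at opposite arguments\<close>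

context
  fixes M :: "'a measure" and X1 X2 :: "'a \<Rightarrow> real" and q1 q2 f :: "real \<Rightarrow> real" and x :: real
  assumes M: "prob_space M" and X1: "X1 \<in> borel_measurable M" and X2: "X2 \<in> borel_measurable M"
    and fin1: "finite_tail_transforms M X1" and fin2: "finite_tail_transforms M X2"
  defines "q1 \<equiv> \<lambda>p. real_of_ereal (quantile M X1 p)" and "q2 \<equiv> \<lambda>p. real_of_ereal (quantile M X2 p)"
  defines "f \<equiv> \<lambda>s. q1 s + q2 (1 - s) - x"
begin

interpretation prob_space unit_measure by (rule prob_space_unit_measure)

lemma integrable_q1: "integrable unit_measure q1"
  and integrable_q2: "integrable unit_measure (\<lambda>s. q2 (1 - s))"
  unfolding q1_def q2_def
  by (rule integrable_quantile[OF M X1 fin1])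
    (rule integrable_unit_measure_reflect[OF integrable_quantile[OF M X2 fin2]])

lemma integrable_quantile_sum: "integrable unit_measure f"
  unfolding f_def using integrable_q1 integrable_q2 by auto

text \<open>Reflection moves the lower tail of \<open>X2\<close> below 1 - t to the points s > t,
  the region of the upper tail of \<open>X1\<close>. There the two integrands combine to f s - f
  t.\<close>

lemma upper_tail_minus_lower_tail_antithetic:
  assumes t: "0 < t" "t < 1"
  shows "upper_tail M X1 (q1 t) - lower_tail M X2 (q2 (1 - t)) =
           (\<integral>s. indicator {t<..} s * f s \<partial>unit_measure) - (1 - t) * f t"
proof -
  have [measurable]: "indicator {t<..} \<in> borel_measurable unit_measure"
    by (rule borel_measurable_unit_measure) auto
  have ind: "integrable unit_measure (indicator {t<..} :: real \<Rightarrow> real)"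
    by (rule integrable_const_bound[where B=1]) (auto split: split_indicator)
  have int: "integrable unit_measure (\<lambda>s. indicator {t<..} s * h s)" if "integrable unit_measure h"
    for h :: "real \<Rightarrow> real"
    by (rule Bochner_Integration.integrable_bound[OF that]) (use that in \<open>auto split: split_indicator\<close>)
  have "lower_tail M X2 (q2 (1 - t)) = (\<integral>s. indicator {..<1 - t} s * (q2 (1 - t) - q2 s) \<partial>unit_measure)"
    unfolding q2_def using t by (intro lower_tail_quantile[OF M X2]) auto
  also have "\<dots> = (\<integral>s. indicator {..<1 - t} (1 - s) * (q2 (1 - t) - q2 (1 - s)) \<partial>unit_measure)"
    by (rule integral_unit_measure_reflect[symmetric])
  also have "\<dots> = (\<integral>s. indicator {t<..} s * (q2 (1 - t) - q2 (1 - s)) \<partial>unit_measure)"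
    by (rule Bochner_Integration.integral_cong) (auto split: split_indicator)
  finally have low: "lower_tail M X2 (q2 (1 - t)) = \<dots>" .
  have "upper_tail M X1 (q1 t) = (\<integral>s. indicator {t<..} s * (q1 s - q1 t) \<partial>unit_measure)"
    unfolding q1_def by (rule upper_tail_quantile[OF M X1 t])
  then have "upper_tail M X1 (q1 t) - lower_tail M X2 (q2 (1 - t)) =
      (\<integral>s. indicator {t<..} s * (q1 s - q1 t) - indicator {t<..} s * (q2 (1 - t) - q2 (1 - s)) \<partial>unit_measure)"
    unfolding low using integrable_q1 integrable_q2
    by (subst Bochner_Integration.integral_diff) (auto intro!: int)
  also have "\<dots> = (\<integral>s. indicator {t<..} s * f s - f t * indicator {t<..} s \<partial>unit_measure)"
    by (rule Bochner_Integration.integral_cong) (auto simp: f_def algebra_simps)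
  also have "\<dots> = (\<integral>s. indicator {t<..} s * f s \<partial>unit_measure) - f t * (\<integral>s. indicator {t<..} s \<partial>unit_measure)"
    using int[OF integrable_quantile_sum] ind by (subst Bochner_Integration.integral_diff) auto
  also have "(\<integral>s. indicator {t<..} s \<partial>unit_measure) = 1 - t"
    using t by (intro integral_unit_measure_greaterThan) auto
  finally show ?thesis by (simp add: mult.commute)
qed

text \<open>Parity for each variable exchanges upper and lower tails in the preceding
  identity.\<close>

lemma upper_tail_minus_lower_tail_antithetic':
  assumes t: "0 < t" "t < 1"
  shows "upper_tail M X2 (q2 (1 - t)) - lower_tail M X1 (q1 t) =
           integral\<^sup>L unit_measure f - (\<integral>s. indicator {t<..} s * f s \<partial>unit_measure) - t * f t"
proof -
  have "integral\<^sup>L unit_measure f = integral\<^sup>L unit_measure q1 + integral\<^sup>L unit_measure q2 - x"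
    unfolding f_def using integrable_q1 integrable_q2 integral_unit_measure_reflect[of q2]
    by simp
  moreover have "upper_tail M X1 (q1 t) - lower_tail M X1 (q1 t) = integral\<^sup>L unit_measure q1 - q1 t"
    using upper_tail_minus_lower_tail[OF M X1 fin1] by (simp add: q1_def)
  moreover have "upper_tail M X2 (q2 (1 - t)) - lower_tail M X2 (q2 (1 - t)) =
      integral\<^sup>L unit_measure q2 - q2 (1 - t)"
    using upper_tail_minus_lower_tail[OF M X2 fin2] by (simp add: q2_def)
  ultimately show ?thesis
    using upper_tail_minus_lower_tail_antithetic[OF t] by (simp add: f_def algebra_simps)
qed

lemma summable_weighted_jumps:
  fixes u :: "nat \<Rightarrow> real" and N :: enat
  assumes N: "1 \<le> N" and u_mono: "strict_mono_on {j. 1 \<le> j \<and> enat j \<le> N} u"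
    and u_in: "\<And>j. 1 \<le> j \<Longrightarrow> enat j \<le> N \<Longrightarrow> u j \<in> sign_changes f"
  shows "summable (alt_term N (\<lambda>j. (1 - u j) * f (u j)))"
proof -
  \<comment> \<open>Both \<open>q1 s\<close> and \<open>- q2 (1 - s)\<close> increase in
    \<open>s\<close>, so increments of \<open>D\<close> dominate the variation of
    \<open>f\<close>.\<close>
  define D where "D s = q1 s - q2 (1 - s)" for s
  have q_mono: "q1 s' \<le> q1 s" "q2 (1 - s) \<le> q2 (1 - s')" if "0 < s'" "s' \<le> s" "s < 1" for s s'
    using monotone_onD[OF mono_on_quantile[OF M X1], of s' s]
      monotone_onD[OF mono_on_quantile[OF M X2], of "1 - s" "1 - s'"] that
    by (auto simp: q1_def q2_def)
  have D_mono: "mono_on {0<..<1} D"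
    by (rule mono_onI) (use q_mono in \<open>force simp: D_def intro: diff_mono\<close>)
  have D_int: "integrable unit_measure D"
    unfolding D_def using integrable_q1 integrable_q2 by auto
  have u01: "0 < u j" "u j < 1" if "1 \<le> j" "enat j \<le> N" for j
    using u_in that by (auto simp: sign_changes_def)
  have enat_le: "enat i \<le> N" if "enat j \<le> N" "i \<le> j" for i j
    using that order_trans[of "enat i" "enat j" N] by simp
  have jump: "\<bar>f w\<bar> \<le> D s - D s'" if w: "w \<in> sign_changes f" "0 < s'" "s' < w" "w < s" "s < 1" for w s s'
  proof -
    have var: "\<bar>f q - f p\<bar> \<le> D s - D s'" if "s' \<le> p" "p \<le> q" "q \<le> s" for p q
    proof -
      have "q1 s' \<le> q1 p" "q1 p \<le> q1 q" "q1 q \<le> q1 s"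
        "q2 (1 - p) \<le> q2 (1 - s')" "q2 (1 - q) \<le> q2 (1 - p)" "q2 (1 - s) \<le> q2 (1 - q)"
        using q_mono that w by auto
      then show ?thesis by (auto simp: f_def D_def)
    qed
    obtain p q where pq: "s' < p" "p < w" "w < q" "q < s" "f p \<le> 0 \<and> 0 \<le> f q \<or> f q \<le> 0 \<and> 0 \<le> f p"
      using sign_changes_bracket[OF w(1,3,4)] by blast
    \<comment> \<open>Whatever the sign of \<open>f w\<close>, one of \<open>f p\<close> and
      \<open>f q\<close> has the weakly opposite sign, so |f w| is at most its distance from that
      value.\<close>
    show ?thesis using var[of p w] var[of w q] pq by linarith
  qed
  \<comment> \<open>A point strictly between 0 and \<open>u 1\<close>; the base point cannot be 0,
    near which \<open>D\<close> may be unbounded below.\<close>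
  define t where "t = u 1 / 2"
  define C where "C = (\<integral>s. indicator {t<..} s * (D s - D t) \<partial>unit_measure)"
  have u1: "0 < u 1" "u 1 < 1" using N u01[of 1] by (auto simp: one_enat_def)
  have bound: "(\<Sum>i<k. (1 - u (Suc i)) * \<bar>f (u (Suc i))\<bar>) \<le> C" if k: "enat k \<le> N" for k
    unfolding C_def
  proof (rule sum_weighted_jumps_le[OF D_mono D_int])
    fix i assume i: "i < k"
    then have i_in: "1 \<le> Suc i" "enat (Suc i) \<le> N" using enat_le[OF k, of "Suc i"] by auto
    show "\<bar>f (u (Suc i))\<bar> \<le> D s - D s'" if "0 < s'" "s' < u (Suc i)" "u (Suc i) < s" "s < 1" for s s'
      by (rule jump[OF u_in[OF i_in] that])
    have "u 1 \<le> u (Suc i)"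
      using strict_mono_on_leD[OF u_mono, of 1 "Suc i"] i_in enat_le[OF i_in(2), of 1] by simp
    then show "t < u (Suc i)" using u1 by (simp add: t_def)
    show "u (Suc i) < 1" using u01[OF i_in] by simp
  next
    show "strict_mono_on {..<k} (\<lambda>i. u (Suc i))"
    proof (rule strict_mono_onI)
      fix i j assume "i \<in> {..<k}" "j \<in> {..<k}" "i < j"
      then show "u (Suc i) < u (Suc j)"
        using strict_mono_onD[OF u_mono, of "Suc i" "Suc j"] enat_le[OF k, of "Suc i"] enat_le[OF k, of "Suc j"]
        by simp
    qed
  qed (use u1 in \<open>simp_all add: t_def\<close>)
  have "summable (\<lambda>j. \<bar>alt_term N (\<lambda>j. (1 - u j) * f (u j)) j\<bar>)"
  proof (rule summableI_nonneg_bounded)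
    fix n
    \<comment> \<open>The bound is indexed by crossings, so a partial sum of length \<open>n\<close>
      is cut off at \<open>N\<close> when \<open>N\<close> is smaller.\<close>
    obtain k where k: "enat k \<le> N" "\<And>j. j < n \<Longrightarrow> enat j \<le> N \<Longrightarrow> j \<le> k"
    proof (cases "enat n \<le> N")
      case True
      then show ?thesis using that[of n] by simp
    next
      case False
      then obtain m where "N = enat m" by (cases N) auto
      then show ?thesis using that[of m] by simp
    qed
    have u_le: "u (Suc i) \<le> 1" if "i < k" for i
      using u01[of "Suc i"] enat_le[OF k(1), of "Suc i"] that by simp
    have "(\<Sum>j<n. \<bar>alt_term N (\<lambda>j. (1 - u j) * f (u j)) j\<bar>) \<le>
        (\<Sum>j<n. if j \<in> {1..k} then (1 - u j) * \<bar>f (u j)\<bar> else 0)"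
    proof (rule sum_mono)
      fix j assume "j \<in> {..<n}"
      then show "\<bar>alt_term N (\<lambda>j. (1 - u j) * f (u j)) j\<bar> \<le>
          (if j \<in> {1..k} then (1 - u j) * \<bar>f (u j)\<bar> else 0)"
        using k(2)[of j] u01[of j] enat_le[OF k(1), of j] by (auto simp: alt_term_def abs_mult)
    qed
    also have "\<dots> = (\<Sum>j\<in>{..<n} \<inter> {1..k}. (1 - u j) * \<bar>f (u j)\<bar>)"
      by (simp add: sum.inter_restrict)
    also have "\<dots> \<le> (\<Sum>j\<in>{1..k}. (1 - u j) * \<bar>f (u j)\<bar>)"
      by (rule sum_mono2) (use u01 enat_le[OF k(1)] in \<open>auto intro!: mult_nonneg_nonneg simp: less_imp_le\<close>)
    also have "\<dots> = (\<Sum>i<k. (1 - u (Suc i)) * \<bar>f (u (Suc i))\<bar>)"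
      by (rule sum.reindex_bij_witness[of _ Suc "\<lambda>j. j - 1"]) auto
    also have "\<dots> \<le> C" by (rule bound[OF k(1)])
    finally show "(\<Sum>j<n. \<bar>alt_term N (\<lambda>j. (1 - u j) * f (u j)) j\<bar>) \<le> C" .
  qed simp
  then show ?thesis by (rule summable_rabs_cancel)
qed

end

section \<open>The stop-loss premium from the alternating sum\<close>

theorem theorem6p1:
  fixes M :: "'a measure" and P :: "'b measure"
    and X1 X2 :: "'a \<Rightarrow> real" and U Sl :: "'b \<Rightarrow> real"
    and q1 q2 g :: "real \<Rightarrow> ereal" and x \<S> \<J> s1 s2 :: real
    and N :: enat and u r1 r2 d :: "nat \<Rightarrow> real"
  assumes "prob_space M" "X1 \<in> borel_measurable M" "X2 \<in> borel_measurable M"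
    and "finite_tail_transforms M X1" "finite_tail_transforms M X2"
    and "prob_space P" "distributed P lborel U (indicator {0..1})"
    and q1: "q1 = quantile M X1" and q2: "q2 = quantile M X2"
    and g: "g = (\<lambda>v. q1 v + q2 (1 - v))"
    and Sl: "Sl = (\<lambda>\<omega>. real_of_ereal (g (U \<omega>)))"
    and nondegenerate: "\<not> (\<exists>c. AE \<omega> in P. Sl \<omega> = c)"
    and "(INF v\<in>{0..1}. g v) < ereal x" "ereal x < (SUP v\<in>{0..1}. g v)"
    and "1 \<le> N" "strict_mono_on {j. 1 \<le> j \<and> enat j \<le> N} u"
    and "u ` {j. 1 \<le> j \<and> enat j \<le> N} = crossing_set g x"
    and "crossings_complete g x"
    and r1: "r1 = (\<lambda>j. real_of_ereal (q1 (u j)))"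
    and r2: "r2 = (\<lambda>j. real_of_ereal (q2 (1 - u j)))"
    and d: "d = (\<lambda>j. real_of_ereal (g (u j)) - x)"
    and \<S>: "\<S> = suminf (alt_term N (\<lambda>j. upper_tail M X1 (r1 j) - lower_tail M X2 (r2 j)))"
    and \<J>: "\<J> = suminf (alt_term N (\<lambda>j. (1 - u j) * d j))"
    and s1: "s1 = upper_tail M X1 (r1 1) - lower_tail M X2 (r2 1) - \<S> + (1 - u 1) * d 1 - \<J>"
    and s2: "s2 = upper_tail M X2 (r2 1) - lower_tail M X1 (r1 1) + \<S> + u 1 * d 1 + \<J>"
  shows "summable (alt_term N (\<lambda>j. upper_tail M X1 (r1 j) - lower_tail M X2 (r2 j))) \<and>
         summable (alt_term N (\<lambda>j. (1 - u j) * d j)) \<and>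
         ((\<forall>v\<in>{0<..<u 1}. g v \<le> ereal x) \<longrightarrow> upper_tail P Sl x = s1) \<and>
         ((\<forall>v\<in>{0<..<u 1}. g v \<ge> ereal x) \<longrightarrow> upper_tail P Sl x = s2)"
proof -
  note prems = assms(1-5)
  define f where "f = (\<lambda>s. real_of_ereal (quantile M X1 s) + real_of_ereal (quantile M X2 (1 - s)) - x)"
  define H where "H t = (\<integral>s. indicator {t<..} s * f s \<partial>unit_measure)" for t
  have f: "integrable unit_measure f"
    unfolding f_def by (rule integrable_quantile_sum[OF prems])
  have [measurable]: "f \<in> borel_measurable unit_measure" using f by auto
  have g_eq: "g v = ereal (f v + x)" if "v \<in> {0<..<1}" for v
    using that by (simp add: g q1 q2 f_def quantile_eq_Inf[OF assms(1,2)] quantile_eq_Inf[OF assms(1,3)])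
  \<comment> \<open>Outside (0,1) one of the quantiles is -\<infinity>, so the sum is infinite and
    \<open>real_of_ereal\<close> returns 0. This makes the integrand measurable on the whole
    line.\<close>
  have g_outside: "real_of_ereal (g v) = 0" if "v \<notin> {0<..<1}" for v
  proof (cases "v \<le> 0")
    case True
    then show ?thesis
      using quantile_nonpos[OF assms(1,2)] by (cases "quantile M X2 (1 - v)") (auto simp: g q1 q2)
  next
    case False
    then show ?thesis
      using that quantile_nonpos[OF assms(1,3), of "1 - v"] by (cases "quantile M X1 v") (auto simp: g q1 q2)
  qed
  have sc: "crossing_set g x = sign_changes f"
    by (rule crossing_set_eq_sign_changes[OF g_eq])
  have u_range: "u ` {j. 1 \<le> j \<and> enat j \<le> N} = sign_changes f" using assms(17) sc by simp
  then have u_in: "u j \<in> sign_changes f" if "1 \<le> j" "enat j \<le> N" for j using that by blast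
  then have u01: "0 < u j" "u j < 1" if "1 \<le> j" "enat j \<le> N" for j
    using that by (auto simp: sign_changes_def)
  have N1: "enat 1 \<le> N" using assms(15) by (simp add: one_enat_def)
  have complete: "\<exists>\<delta>\<in>{1, -1}. AE s in lborel. s \<in> {v<..<w} \<longrightarrow> 0 \<le> \<delta> * f s"
    if vw: "0 \<le> v" "v < w" "w \<le> 1" "sign_changes f \<inter> {v<..<w} = {}" for v w
  proof -
    have "(AE s in lborel. s \<in> {v<..<w} \<longrightarrow> g s \<le> ereal x) \<or> (AE s in lborel. s \<in> {v<..<w} \<longrightarrow> g s \<ge> ereal x)"
      using assms(18) vw unfolding crossings_complete_def sc by blast
    then show ?thesis
    proof
      assume ae: "AE s in lborel. s \<in> {v<..<w} \<longrightarrow> g s \<le> ereal x"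
      have "AE s in lborel. s \<in> {v<..<w} \<longrightarrow> 0 \<le> -1 * f s"
        using ae by eventually_elim (use vw g_eq in auto)
      then show ?thesis by blast
    next
      assume ae: "AE s in lborel. s \<in> {v<..<w} \<longrightarrow> g s \<ge> ereal x"
      have "AE s in lborel. s \<in> {v<..<w} \<longrightarrow> 0 \<le> 1 * f s"
        using ae by eventually_elim (use vw g_eq in auto)
      then show ?thesis by blast
    qed
  qed
  have beyond: "AE s in lborel. s \<in> {0<..<1} \<and> (\<forall>t\<in>sign_changes f. t < s) \<longrightarrow> f s = 0"
    if "infinite (sign_changes f)"
  proof -
    have "AE s in lborel. s \<in> {0<..<1} \<and> (\<forall>t\<in>sign_changes f. t < s) \<longrightarrow> g s = ereal x"
      using assms(18) that unfolding crossings_complete_def sc by blast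
    then show ?thesis by eventually_elim (use g_eq in auto)
  qed
  obtain T where T: "alt_term N (\<lambda>j. H (u j)) sums (H (u 1) - T)"
    and T_eq: "\<And>\<sigma>. \<sigma> \<in> {1, -1} \<Longrightarrow> \<forall>s\<in>{0<..<u 1}. \<sigma> * f s \<le> 0 \<Longrightarrow>
           \<sigma> * T = (\<integral>s. max (\<sigma> * f s) 0 \<partial>unit_measure)"
    unfolding H_def
    using alternating_sign_changes[OF f assms(15,16) u_range complete beyond] by blast
  have d_eq: "d j = f (u j)" if "1 \<le> j" "enat j \<le> N" for j
    using u01[OF that] by (simp add: d g_eq)
  have A_eq: "upper_tail M X1 (r1 j) - lower_tail M X2 (r2 j) = H (u j) - (1 - u j) * d j"
    if "1 \<le> j" "enat j \<le> N" for j
    unfolding d_eq[OF that] H_def r1 r2 q1 q2 f_def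
    by (rule upper_tail_minus_lower_tail_antithetic[OF prems u01[OF that]])
  have B_eq: "upper_tail M X2 (r2 1) - lower_tail M X1 (r1 1) = integral\<^sup>L unit_measure f - H (u 1) - u 1 * d 1"
    unfolding d_eq[OF order_refl N1] H_def r1 r2 q1 q2 f_def
    by (rule upper_tail_minus_lower_tail_antithetic'[OF prems u01[OF order_refl N1]])
  have "summable (alt_term N (\<lambda>j. (1 - u j) * f (u j)))"
    unfolding f_def
    by (rule summable_weighted_jumps[OF prems assms(15,16) u_in[unfolded f_def]])
  moreover have "alt_term N (\<lambda>j. (1 - u j) * d j) = alt_term N (\<lambda>j. (1 - u j) * f (u j))"
    by (auto simp: alt_term_def d_eq)
  ultimately have J_summable: "summable (alt_term N (\<lambda>j. (1 - u j) * d j))" by simp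
  \<comment> \<open>The convergent series of the \<open>H (u j)\<close> minus the absolutely
    convergent jump series: this is how the series \<S> converges by itself.\<close>
  have A_diff: "alt_term N (\<lambda>j. upper_tail M X1 (r1 j) - lower_tail M X2 (r2 j)) =
      (\<lambda>j. alt_term N (\<lambda>j. H (u j)) j - alt_term N (\<lambda>j. (1 - u j) * d j) j)"
    by (auto simp: alt_term_def A_eq right_diff_distrib)
  have S_sums: "alt_term N (\<lambda>j. upper_tail M X1 (r1 j) - lower_tail M X2 (r2 j)) sums (H (u 1) - T - \<J>)"
    unfolding A_diff \<J> by (rule sums_diff[OF T summable_sums[OF J_summable]])
  have "\<S> = H (u 1) - T - \<J>" unfolding \<S> using sums_unique[OF S_sums] by simp
  \<comment> \<open>The terms with \<open>H (u 1)\<close>, \<open>d 1\<close> and \<J> all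
    cancel.\<close>
  then have s1_eq: "s1 = T" and s2_eq: "s2 = integral\<^sup>L unit_measure f - T"
    using A_eq[OF order_refl N1] B_eq by (simp_all add: s1 s2)
  have "(\<lambda>s. real_of_ereal (g s)) = (\<lambda>s. indicator {0<..<1} s * (f s + x))"
    using g_eq g_outside by (auto split: split_indicator)
  moreover have "(\<lambda>s. indicator {0<..<1} s * (f s + x)) \<in> borel_measurable lborel"
  proof -
    have "(\<lambda>s. f s + x) \<in> borel_measurable (restrict_space lborel {0<..<1})"
      unfolding unit_measure_def[symmetric] by measurable
    then show ?thesis by (subst (asm) borel_measurable_restrict_space_iff) (auto simp: mult.commute)
  qed
  ultimately have g_meas: "(\<lambda>s. real_of_ereal (g s)) \<in> borel_measurable lborel" by simp
  have dist: "distributed P lborel U (\<lambda>s. ennreal (indicator {0..1} s))"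
    using assms(7) by (simp add: ennreal_indicator)
  have "upper_tail P Sl x = (\<integral>\<omega>. max (real_of_ereal (g (U \<omega>)) - x) 0 \<partial>P)"
    by (simp add: upper_tail_def Sl)
  also have "\<dots> = (\<integral>s. indicator {0..1} s * max (real_of_ereal (g s) - x) 0 \<partial>lborel)"
    by (rule distributed_integral[OF dist, symmetric]) (use g_meas in auto)
  also have "\<dots> = (\<integral>s. indicator {0<..<1} s * max (real_of_ereal (g s) - x) 0 \<partial>lborel)"
  \<comment> \<open>\<open>U\<close> is uniform on the closed interval, whose end points are
    null.\<close>
  proof (rule integral_cong_AE)
    show "AE s in lborel. indicator {0..1} s * max (real_of_ereal (g s) - x) 0 =
        indicator {0<..<1} s * max (real_of_ereal (g s) - x) 0"
      using AE_lborel_singleton[of 0] AE_lborel_singleton[of 1]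
      by eventually_elim (auto split: split_indicator)
  qed (use g_meas in measurable)
  also have "\<dots> = (\<integral>s. max (real_of_ereal (g s) - x) 0 \<partial>unit_measure)"
    by (simp add: integral_unit_measure)
  also have "\<dots> = (\<integral>s. max (f s) 0 \<partial>unit_measure)"
    by (rule Bochner_Integration.integral_cong) (auto simp: g_eq)
  finally have Sl_eq: "upper_tail P Sl x = \<dots>" .
  have u1: "u 1 < 1" using u01[OF order_refl N1] by simp
  have "upper_tail P Sl x = s1" if "\<forall>v\<in>{0<..<u 1}. g v \<le> ereal x"
  proof -
    have "f s \<le> 0" if "s \<in> {0<..<u 1}" for s
    proof -
      have "g s \<le> ereal x" using \<open>\<forall>v\<in>{0<..<u 1}. g v \<le> ereal x\<close> that by blast
      then show ?thesis using g_eq[of s] that u1 by simp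
    qed
    then show ?thesis using T_eq[of 1] by (simp add: s1_eq Sl_eq)
  qed
  moreover have "upper_tail P Sl x = s2" if "\<forall>v\<in>{0<..<u 1}. g v \<ge> ereal x"
  proof -
    have "f s \<ge> 0" if "s \<in> {0<..<u 1}" for s
    proof -
      have "g s \<ge> ereal x" using \<open>\<forall>v\<in>{0<..<u 1}. g v \<ge> ereal x\<close> that by blast
      then show ?thesis using g_eq[of s] that u1 by simp
    qed
    then have "- T = (\<integral>s. max (- f s) 0 \<partial>unit_measure)" using T_eq[of "-1"] by simp
    \<comment> \<open>For \<sigma> = -1 the number -T is the integral of the negative part of
      \<open>f\<close>; adding the integral of \<open>f\<close> gives that of the positive
      part.\<close>
    moreover have "(\<integral>s. max (f s) 0 \<partial>unit_measure) = integral\<^sup>L unit_measure f + (\<integral>s. max (- f s) 0 \<partial>unit_measure)"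
    proof -
      have "(\<lambda>s. max (f s) 0) = (\<lambda>s. f s + max (- f s) 0)" by auto
      then show ?thesis using f by (simp add: Bochner_Integration.integral_add)
    qed
    ultimately show ?thesis by (simp add: s2_eq Sl_eq)
  qed
  ultimately show ?thesis using J_summable sums_summable[OF S_sums] by blast
qed

end
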